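(* Let $A\in\mathbb{R}^{m\times n}$, $b\in\mathbb{R}^m$, $p\in\{1,2\}$, and let $\phi:\mathbb{R}_+\to\mathbb{R}_+$ be continuous and nondecreasing with $\phi(0)=0$. Let $L$, $s_i,\rho_i,\Omega_i$ ($i\in\mathbb{N}_L^0$) and $K$, $\Lambda_i$ ($i=-1,0,\dots,K-1$), $t_i,\lambda_i$ ($i\in\mathbb{N}_K^0$) be produced by Iterations 1 and 2 of the context. Let $f_i(\lambda):=s_i+\lambda\rho_i$ for $i\in\mathbb{N}_L^0$, and for $\lambda>0$ let $$F(\lambda):=\min\{\|x\|_0+\lambda\phi(\|Ax-b\|_p):x\in\mathbb{R}^n\},\qquad \Omega(\lambda):=\arg\min\{\|x\|_0+\lambda\phi(\|Ax-b\|_p):x\in\mathbb{R}^n\}.$$ If $L=0$, then $F(\lambda)=\rho_0\lambda$ and $\Omega(\lambda)=\{\mathbf{0}_n\}$ for all $\lambda>0$. If $L\ge 1$, then: (i) $F(\lambda)=f_L(\lambda)$ if $\lambda\in(0,\lambda_{K-1}]$; $F(\lambda)=f_{t_i}(\lambda)$ if $\lambda\in(\lambda_i,\lambda_{i-1}]$, $i\in\mathbb{N}_{K-1}$; $F(\lambda)=f_0(\lambda)$ if $\lambda\in(\lambda_0,+\infty)$. (ii) $\Omega(\lambda)=\Omega_L=\{\mathbf{0}_n\}$ if $\lambda\in(0,\lambda_{K-1})$; $\Omega(\lambda)=\Omega_{t_i}$ if $\lambda\in(\lambda_i,\lambda_{i-1})$, $i\in\mathbb{N}_{K-1}$; $\Omega(\lambda)=\Omega_0$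 if $\lambda\in(\lambda_0,+\infty)$; and $\Omega(\lambda)=\bigcup_{k\in\Lambda_i}\Omega_k\cup\Omega_{t_i}$ if $\lambda=\lambda_i$, $i\in\mathbb{N}_{K-1}^0$. (iii) $F$ is continuous, piecewise linear and nondecreasing on $(0,+\infty)$; in particular, $F$ is strictly increasing in $(0,\lambda_0)$.
   Context: $\mathbb{R}_+=[0,+\infty)$; $\mathbb{N}_k=\{1,\dots,k\}$ (with $\mathbb{N}_0=\emptyset$), $\mathbb{N}_k^0=\{0,1,\dots,k\}$; $\mathbf{0}_n$ is the zero vector of $\mathbb{R}^n$; $\|x\|_0$ is the number of nonzero components of $x$; $\arg\min$, $\arg\max$ denote the sets of all global minimizers/maximizers. Iteration 1 (depending on $A,b,p,\phi$). Set $i=0$ and $\rho_0:=\min\{\phi(\|Ax-b\|_p):x\in\mathbb{R}^n\}$, $s_0:=\min\{\|x\|_0:\phi(\|Ax-b\|_p)=\rho_0,\ x\in\mathbb{R}^n\}$, $\Omega_0:=\arg\min\{\|x\|_0:\phi(\|Ax-b\|_p)=\rho_0,\ x\in\mathbb{R}^n\}$. While $s_i>0$: put $\rho_{i+1}:=\min\{\phi(\|Ax-b\|_p):\|x\|_0\le s_i-1,\ x\in\mathbb{R}^n\}$, $s_{i+1}:=\min\{\|x\|_0:\phi(\|Ax-b\|_p)=\rho_{i+1},\ x\in\mathbb{R}^n\}$, $\Omega_{i+1}:=\arg\min\{\|x\|_0:\phi(\|Ax-b\|_p)=\rho_{i+1},\ x\in\mathbb{R}^n\}$, and replace $i$ by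 $i+1$. When the loop ends (i.e. $s_i=0$), set $L:=i$. (All these minima are attained and the iteration terminates.) Iteration 2. Set $i=0$ and $\Lambda_{-1}:=\{0\}$. While $L\notin\Lambda_{i-1}$: put $t_i:=\max\Lambda_{i-1}$, $\lambda_i:=\max\{\frac{s_{t_i}-s_j}{\rho_j-\rho_{t_i}}:j=t_i+1,\dots,L\}$, $\Lambda_i:=\arg\max\{\frac{s_{t_i}-s_j}{\rho_j-\rho_{t_i}}:j=t_i+1,\dots,L\}$ (a set of indices $j$), and replace $i$ by $i+1$. When the loop ends, set $K:=i$, $t_K:=L$, $\lambda_K:=0$. *)

theory Defs
  imports "HOL-Analysis.Analysis" "HOL-Library.Disjoint_Sets"
begin

definition l0norm :: "real ^ 'n \<Rightarrow> nat" where
  "l0norm x = card {i. x $ i \<noteq> 0}"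

definition lpnorm :: "nat \<Rightarrow> real ^ 'm \<Rightarrow> real" where
  "lpnorm p y = root p (\<Sum>i\<in>UNIV. \<bar>y $ i\<bar> ^ p)"

text \<open>The minimum of \<open>h\<close> over \<open>{x. P x}\<close>, as an attained value: unlike \<open>Inf\<close>, it is
  unspecified if no minimizer exists.\<close>

definition min_value :: "('a \<Rightarrow> 'b::order) \<Rightarrow> ('a \<Rightarrow> bool) \<Rightarrow> 'b" where
  "min_value h P = (LEAST v. \<exists>x. P x \<and> v = h x)"

definition argmin_set :: "('a \<Rightarrow> 'b::ord) \<Rightarrow> ('a \<Rightarrow> bool) \<Rightarrow> 'a set" where
  "argmin_set h P = {x. is_arg_min h P x}"

definition argmax_set :: "('a \<Rightarrow> 'b::ord) \<Rightarrow> ('a \<Rightarrow> bool) \<Rightarrow> 'a set" where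
  "argmax_set h P = {x. is_arg_max h P x}"

text \<open>Iteration 1, for the data-fitting term \<open>g x = \<phi> (lpnorm p (A *v x - b))\<close>.
  The sequences are defined for every index \<open>i\<close>, but only the indices \<open>i \<le> L\<close> are meaningful;
  for \<open>i < L\<close> the current sparsity level is positive, so the subtraction of 1 does not truncate.\<close>

definition min_sparsity :: "(real ^ 'n \<Rightarrow> real) \<Rightarrow> real \<Rightarrow> nat" where
  "min_sparsity g r = min_value l0norm (\<lambda>x. g x = r)"

primrec iter1_rho :: "(real ^ 'n \<Rightarrow> real) \<Rightarrow> nat \<Rightarrow> real" where
  "iter1_rho g 0 = min_value g (\<lambda>x. True)"
| "iter1_rho g (Suc i) = min_value g (\<lambda>x. l0norm x \<le> min_sparsity g (iter1_rho g i) - 1)"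

definition iter1_s :: "(real ^ 'n \<Rightarrow> real) \<Rightarrow> nat \<Rightarrow> nat" where
  "iter1_s g i = min_sparsity g (iter1_rho g i)"

definition iter1_Omega :: "(real ^ 'n \<Rightarrow> real) \<Rightarrow> nat \<Rightarrow> (real ^ 'n) set" where
  "iter1_Omega g i = argmin_set l0norm (\<lambda>x. g x = iter1_rho g i)"

definition iter1_L :: "(real ^ 'n \<Rightarrow> real) \<Rightarrow> nat" where
  "iter1_L g = (LEAST i. iter1_s g i = 0)"

text \<open>Iteration 2, for the output \<open>\<rho>\<close>, \<open>s\<close>, \<open>L\<close> of Iteration 1. As the sets \<open>\<Lambda>\<close> are indexed
  from \<open>-1\<close>, \<open>iter2_Lambda_prev \<rho> s L i\<close> stands for \<open>\<Lambda>\<close> at index \<open>i - 1\<close>. Again only the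
  indices reached by the loop are meaningful.\<close>

definition ratio :: "(nat \<Rightarrow> real) \<Rightarrow> (nat \<Rightarrow> nat) \<Rightarrow> nat \<Rightarrow> nat \<Rightarrow> real" where
  "ratio \<rho> s t j = (real (s t) - real (s j)) / (\<rho> j - \<rho> t)"

primrec iter2_Lambda_prev :: "(nat \<Rightarrow> real) \<Rightarrow> (nat \<Rightarrow> nat) \<Rightarrow> nat \<Rightarrow> nat \<Rightarrow> nat set" where
  "iter2_Lambda_prev \<rho> s L 0 = {0}"
| "iter2_Lambda_prev \<rho> s L (Suc i) =
    (let t = Max (iter2_Lambda_prev \<rho> s L i)
     in argmax_set (ratio \<rho> s t) (\<lambda>j. j \<in> {t + 1..L}))"

definition iter2_Lambda :: "(nat \<Rightarrow> real) \<Rightarrow> (nat \<Rightarrow> nat) \<Rightarrow> nat \<Rightarrow> nat \<Rightarrow> nat set" where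
  "iter2_Lambda \<rho> s L i = iter2_Lambda_prev \<rho> s L (Suc i)"

definition iter2_K :: "(nat \<Rightarrow> real) \<Rightarrow> (nat \<Rightarrow> nat) \<Rightarrow> nat \<Rightarrow> nat" where
  "iter2_K \<rho> s L = (LEAST i. L \<in> iter2_Lambda_prev \<rho> s L i)"

definition iter2_t :: "(nat \<Rightarrow> real) \<Rightarrow> (nat \<Rightarrow> nat) \<Rightarrow> nat \<Rightarrow> nat \<Rightarrow> nat" where
  "iter2_t \<rho> s L i = (if i < iter2_K \<rho> s L then Max (iter2_Lambda_prev \<rho> s L i) else L)"

definition iter2_lambda :: "(nat \<Rightarrow> real) \<Rightarrow> (nat \<Rightarrow> nat) \<Rightarrow> nat \<Rightarrow> nat \<Rightarrow> real" where
  "iter2_lambda \<rho> s L i =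
    (if i < iter2_K \<rho> s L
     then Max (ratio \<rho> s (iter2_t \<rho> s L i) ` {iter2_t \<rho> s L i + 1..L})
     else 0)"

text \<open>Piecewise linear in the usual sense of piecewise affine with finitely many pieces,
  each of which is an interval.\<close>

definition piecewise_linear_on :: "real set \<Rightarrow> (real \<Rightarrow> real) \<Rightarrow> bool" where
  "piecewise_linear_on S h \<longleftrightarrow>
    (\<exists>P. finite P \<and> partition_on S P \<and>
      (\<forall>I\<in>P. is_interval I \<and> (\<exists>c d. \<forall>x\<in>I. h x = c * x + d)))"

end

theory Submission
  imports Defs
begin

text \<open>Every \<open>x\<close> is dominated, in sparsity and in data-fitting value at once, by one of the pairs
  \<open>(s\<^sub>i, \<rho>\<^sub>i)\<close> of Iteration 1. Hence \<open>F\<close> is the lower envelope of the lines \<open>f\<^sub>0, \<dots>, f\<^sub>L\<close>, and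
  \<open>\<Omega>(\<mu>)\<close> is the union of the \<open>\<Omega>\<^sub>j\<close> over the lines \<open>j\<close> that are lowest at \<open>\<mu>\<close>. Iteration 2 walks along
  this envelope from right to left: starting on line \<open>t\<^sub>i\<close>, it finds the rightmost point \<open>\<lambda>\<^sub>i\<close> where
  a steeper line crosses it, and continues on the steepest of the lines crossing there.\<close>

lemma argmin_set_eq:
  fixes h :: "'a \<Rightarrow> 'b::linorder"
  shows "argmin_set h P = {x. P x \<and> (\<forall>y. P y \<longrightarrow> h x \<le> h y)}"
  by (auto simp: argmin_set_def is_arg_min_linorder)

lemma argmax_set_eq:
  fixes h :: "'a \<Rightarrow> 'b::linorder"
  shows "argmax_set h P = {x. P x \<and> (\<forall>y. P y \<longrightarrow> h y \<le> h x)}"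
  by (auto simp: argmax_set_def is_arg_max_linorder)

subsection \<open>The lower envelope traced by Iteration 2\<close>

locale envelope =
  fixes \<rho> :: "nat \<Rightarrow> real" and s :: "nat \<Rightarrow> nat" and L :: nat
  assumes s_less: "i < j \<Longrightarrow> j \<le> L \<Longrightarrow> s j < s i"
    and rho_less: "i < j \<Longrightarrow> j \<le> L \<Longrightarrow> \<rho> i < \<rho> j"
begin

abbreviation "K \<equiv> iter2_K \<rho> s L"
abbreviation "\<Lambda> \<equiv> iter2_Lambda \<rho> s L"
abbreviation "t \<equiv> iter2_t \<rho> s L"
abbreviation "lam \<equiv> iter2_lambda \<rho> s L"

section \<open>Lines and their crossing points\<close>

definition f :: "nat \<Rightarrow> real \<Rightarrow> real" where
  "f j \<mu> = s j + \<mu> * \<rho> j"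

text \<open>\<open>ratio \<rho> s i j\<close> is the abscissa at which lines \<open>i\<close> and
  \<open>j\<close> cross. Line \<open>j\<close> has the larger slope, so line \<open>i\<close> is
  the lower one to the right of the crossing.\<close>

lemma f_le_iff: "i < j \<Longrightarrow> j \<le> L \<Longrightarrow> f i \<mu> \<le> f j \<mu> \<longleftrightarrow> ratio \<rho> s i j \<le> \<mu>"
  and f_less_iff: "i < j \<Longrightarrow> j \<le> L \<Longrightarrow> f i \<mu> < f j \<mu> \<longleftrightarrow> ratio \<rho> s i j < \<mu>"
  using rho_less[of i j] by (auto simp: f_def ratio_def field_simps)

lemma ratio_pos: "i < j \<Longrightarrow> j \<le> L \<Longrightarrow> 0 < ratio \<rho> s i j"
  using rho_less[of i j] s_less[of i j] by (simp add: ratio_def)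

section \<open>Progress and termination of Iteration 2\<close>

lemma Lambda_prev_subset: "iter2_Lambda_prev \<rho> s L i \<subseteq> {..L}"
  by (cases i) (auto simp: argmax_set_eq Let_def)

lemma finite_Lambda_prev: "finite (iter2_Lambda_prev \<rho> s L i)"
  using Lambda_prev_subset by (rule finite_subset) simp

text \<open>Candidates start at \<open>t + 1\<close>, so each pass raises the maximum by at least
  one. Nonemptiness is carried along because \<open>Max\<close> is meaningful only for nonempty
  sets.\<close>

lemma Max_Lambda_prev:
  assumes "\<And>j. j < i \<Longrightarrow> L \<notin> iter2_Lambda_prev \<rho> s L j"
  shows "iter2_Lambda_prev \<rho> s L i \<noteq> {} \<and> i \<le> Max (iter2_Lambda_prev \<rho> s L i)"
  using assms
proof (induction i)
  case (Suc i)
  let ?M = "Max (iter2_Lambda_prev \<rho> s L i)"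
  have IH: "iter2_Lambda_prev \<rho> s L i \<noteq> {}" "i \<le> ?M"
    using Suc by auto
  have "?M \<in> iter2_Lambda_prev \<rho> s L i"
    using IH finite_Lambda_prev by (intro Max_in) auto
  moreover have "L \<notin> iter2_Lambda_prev \<rho> s L i"
    using Suc by simp
  ultimately have "?M < L"
    using Lambda_prev_subset[of i] by (metis atMost_iff le_neq_implies_less subsetD)
  then have "\<exists>j. is_arg_max (ratio \<rho> s ?M) (\<lambda>j. j \<in> {?M + 1..L}) j"
    using ex_is_arg_min_if_finite[of "{?M + 1..L}" "\<lambda>j. - ratio \<rho> s ?M j"]
    by (auto simp: is_arg_min_linorder is_arg_max_linorder)
  then have ne: "iter2_Lambda_prev \<rho> s L (Suc i) \<noteq> {}"
    by (auto simp: Let_def argmax_set_def)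
  then have "Max (iter2_Lambda_prev \<rho> s L (Suc i)) \<in> iter2_Lambda_prev \<rho> s L (Suc i)"
    using finite_Lambda_prev by (intro Max_in)
  then have "?M + 1 \<le> Max (iter2_Lambda_prev \<rho> s L (Suc i))"
    by (simp add: Let_def argmax_set_eq)
  with ne IH show ?case
    by simp
qed simp

text \<open>Otherwise the maximum at stage \<open>Suc L\<close> would be at least
  \<open>Suc L\<close>, although all sets stay inside \<open>{..L}\<close>.\<close>

lemma L_in_Lambda_prev_K: "L \<in> iter2_Lambda_prev \<rho> s L K"
proof -
  have "\<exists>i. L \<in> iter2_Lambda_prev \<rho> s L i"
  proof (rule ccontr)
    assume *: "\<nexists>i. L \<in> iter2_Lambda_prev \<rho> s L i"
    then have "iter2_Lambda_prev \<rho> s L (Suc L) \<noteq> {}" "Suc L \<le> Max (iter2_Lambda_prev \<rho> s L (Suc L))"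
      using Max_Lambda_prev by blast+
    then show False
      using Max_in[OF finite_Lambda_prev] Lambda_prev_subset
      by (metis atMost_iff not_less_eq_eq subsetD)
  qed
  then show ?thesis
    unfolding iter2_K_def by (rule LeastI_ex)
qed

lemma L_notin_Lambda_prev: "i < K \<Longrightarrow> L \<notin> iter2_Lambda_prev \<rho> s L i"
  unfolding iter2_K_def by (rule not_less_Least)

lemma Lambda_prev_nonempty: "i \<le> K \<Longrightarrow> iter2_Lambda_prev \<rho> s L i \<noteq> {}"
  using Max_Lambda_prev L_notin_Lambda_prev by simp

text \<open>The closing convention \<open>t K = L\<close> fits the rule for smaller indices, as
  \<open>L\<close> lies in the \<open>K\<close>-th set and no index exceeds it. This lets later
  lemmas include the case \<open>i = K\<close>.\<close>

lemma t_eq: "i \<le> K \<Longrightarrow> t i = Max (iter2_Lambda_prev \<rho> s L i)"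
  using L_in_Lambda_prev_K Lambda_prev_subset[of K] finite_Lambda_prev[of K]
  by (auto simp: iter2_t_def not_less intro!: Max_eqI[symmetric])

lemma t_in: "i \<le> K \<Longrightarrow> t i \<in> iter2_Lambda_prev \<rho> s L i"
  by (simp add: t_eq finite_Lambda_prev Lambda_prev_nonempty)

lemma t_le_L: "t i \<le> L"
  using t_in[of i] Lambda_prev_subset[of i] by (cases "i < K") (auto simp: iter2_t_def)

lemma t_less_L: "i < K \<Longrightarrow> t i < L"
  using t_in[of i] L_notin_Lambda_prev[of i] t_le_L[of i] by (cases "t i = L") auto

lemma t_0: "t 0 = 0"
  using t_in[of 0] by simp

lemma t_K: "t K = L"
  by (simp add: iter2_t_def)

lemma lam_K: "lam K = 0"
  by (simp add: iter2_lambda_def)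

lemma K_pos: "L > 0 \<Longrightarrow> K > 0"
  using t_0 t_K by (cases "K = 0") auto

section \<open>Breakpoints, and optimality of line \<open>t i\<close> between them\<close>

lemma ratio_le_lam: "i < K \<Longrightarrow> t i < j \<Longrightarrow> j \<le> L \<Longrightarrow> ratio \<rho> s (t i) j \<le> lam i"
  by (auto simp: iter2_lambda_def intro: Max_ge)

text \<open>\<open>lam i\<close> is an attained maximum, so having the maximal ratio means having
  ratio \<open>lam i\<close>, that is, crossing line \<open>t i\<close> exactly at
  \<open>lam i\<close>.\<close>

lemma Lambda_eq:
  assumes "i < K"
  shows "\<Lambda> i = {j. t i < j \<and> j \<le> L \<and> ratio \<rho> s (t i) j = lam i}"
proof -
  have "lam i \<in> ratio \<rho> s (t i) ` {t i + 1..L}"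
    using assms t_less_L[OF assms] by (auto simp: iter2_lambda_def intro!: Max_in)
  then obtain m where "t i < m" "m \<le> L" "ratio \<rho> s (t i) m = lam i"
    by (metis (no_types, lifting) Suc_eq_plus1 Suc_le_eq atLeastAtMost_iff imageE)
  then have "ratio \<rho> s (t i) j = lam i \<longleftrightarrow> (\<forall>k. t i < k \<and> k \<le> L \<longrightarrow> ratio \<rho> s (t i) k \<le> ratio \<rho> s (t i) j)"
    if "t i < j" "j \<le> L" for j
    using ratio_le_lam[OF assms] that by (metis order_antisym)
  moreover have "\<Lambda> i = argmax_set (ratio \<rho> s (t i)) (\<lambda>j. j \<in> {t i + 1..L})"
    using t_eq[of i] assms by (simp add: iter2_Lambda_def Let_def)
  ultimately show ?thesis
    by (auto simp: argmax_set_eq Suc_le_eq)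
qed

lemma t_Suc_in_Lambda: "i < K \<Longrightarrow> t (Suc i) \<in> \<Lambda> i"
  using t_in[of "Suc i"] by (simp add: iter2_Lambda_def)

lemma
  assumes "i < K"
  shows t_less_Suc: "t i < t (Suc i)"
    and lam_eq: "ratio \<rho> s (t i) (t (Suc i)) = lam i"
  using t_Suc_in_Lambda[OF assms] by (auto simp: Lambda_eq[OF assms])

lemma lam_pos: "i < K \<Longrightarrow> lam i > 0"
  using ratio_pos[OF t_less_Suc t_le_L] lam_eq by metis

lemma f_t_Suc_lam: "i < K \<Longrightarrow> f (t (Suc i)) (lam i) = f (t i) (lam i)"
  using f_le_iff[OF t_less_Suc t_le_L, of i "lam i"] f_less_iff[OF t_less_Suc t_le_L, of i "lam i"]
  by (simp add: lam_eq)

text \<open>Strictness comes from \<open>t (i + 1)\<close> being the largest index attaining the maximal ratio.\<close>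

lemma lam_Suc_less:
  assumes "Suc i < K"
  shows "lam (Suc i) < lam i"
proof -
  define j where "j = t (Suc (Suc i))"
  have j: "t (Suc i) < j" "j \<le> L"
    using assms t_less_Suc t_le_L by (auto simp: j_def)
  then have ij: "t i < j"
    using t_less_Suc[of i] assms by simp
  have "j \<notin> \<Lambda> i"
    using j t_eq[of "Suc i"] Max_ge[OF finite_Lambda_prev, of j "Suc i"] assms
    by (auto simp: iter2_Lambda_def)
  then have "ratio \<rho> s (t i) j < lam i"
    using ratio_le_lam[of i j] Lambda_eq[of i] assms j ij by auto
  \<comment> \<open>At \<open>lam i\<close>, line \<open>j\<close> is strictly above line
    \<open>t i\<close>, hence above line \<open>t (Suc i)\<close>, which meets \<open>t i\<close>
    there; so \<open>j\<close> crosses \<open>t (Suc i)\<close> strictly to the left of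
    \<open>lam i\<close>.\<close>
  then have "f (t i) (lam i) < f j (lam i)"
    using f_less_iff[OF ij j(2)] by simp
  then have "f (t (Suc i)) (lam i) < f j (lam i)"
    using f_t_Suc_lam assms by simp
  then have "ratio \<rho> s (t (Suc i)) j < lam i"
    using f_less_iff[OF j] by simp
  then show ?thesis
    using lam_eq[of "Suc i"] assms by (simp add: j_def)
qed

text \<open>Later lines are steeper and, \<open>lam i\<close> being the largest ratio, cross line
  \<open>t i\<close> no further right than \<open>lam i\<close>.\<close>

lemma f_t_le_right:
  assumes "t i < j" "j \<le> L" "lam i \<le> \<mu>" "i \<le> K"
  shows "f (t i) \<mu> \<le> f j \<mu>" and "lam i < \<mu> \<Longrightarrow> f (t i) \<mu> < f j \<mu>"
proof -
  have "i < K"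
    using assms t_K by (cases "i = K") auto
  then have "ratio \<rho> s (t i) j \<le> lam i"
    using assms ratio_le_lam by simp
  then show "f (t i) \<mu> \<le> f j \<mu>" and "lam i < \<mu> \<Longrightarrow> f (t i) \<mu> < f j \<mu>"
    using assms f_le_iff f_less_iff by auto
qed

text \<open>The later line is the steeper one, so its advantage over line \<open>i\<close> can only
  grow towards the left.\<close>

lemma f_diff_mono:
  assumes "i < j" "j \<le> L" "\<mu> \<le> \<nu>" "f j \<nu> \<le> f i \<nu>"
  shows "f j \<mu> \<le> f i \<mu>" and "\<mu> < \<nu> \<Longrightarrow> f j \<mu> < f i \<mu>"
proof -
  have "\<nu> \<le> ratio \<rho> s i j"
    using assms f_less_iff[OF assms(1,2), of \<nu>] by linarith
  then show "f j \<mu> \<le> f i \<mu>" and "\<mu> < \<nu> \<Longrightarrow> f j \<mu> < f i \<mu>"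
    using assms f_less_iff[OF assms(1,2), of \<mu>] f_le_iff[OF assms(1,2), of \<mu>] by linarith+
qed

text \<open>By \<open>f_diff_mono\<close> it suffices to compare at \<open>lam i\<close>, where line
  \<open>t (Suc i)\<close> is as high as line \<open>t i\<close>. There line \<open>t i\<close> is
  not above line \<open>j\<close>: for \<open>j > t i\<close> by the choice of \<open>lam i\<close>,
  for \<open>j < t i\<close> by the induction hypothesis, which applies because
  \<open>lam i < lam (i - 1)\<close>.\<close>

lemma f_t_le_left:
  assumes "Suc i \<le> K" "j < t (Suc i)" "\<mu> \<le> lam i"
  shows "f (t (Suc i)) \<mu> \<le> f j \<mu> \<and> (\<mu> < lam i \<longrightarrow> f (t (Suc i)) \<mu> < f j \<mu>)"
  using assms
proof (induction i arbitrary: j \<mu>)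
  case 0
  then have "f 0 (lam 0) \<le> f j (lam 0)"
    using f_t_le_right(1)[of 0 j "lam 0"] t_0 t_le_L[of "Suc 0"] by (cases "j = 0") auto
  then have "f (t (Suc 0)) (lam 0) \<le> f j (lam 0)"
    using f_t_Suc_lam[of 0] 0 t_0 by simp
  then show ?case
    using f_diff_mono[OF \<open>j < t (Suc 0)\<close> t_le_L] 0 by blast
next
  case (Suc i)
  have "f (t (Suc i)) (lam (Suc i)) \<le> f j (lam (Suc i))"
  proof (cases j "t (Suc i)" rule: linorder_cases)
    case less
    then show ?thesis
      using Suc.IH[of j "lam (Suc i)"] lam_Suc_less[of i] Suc.prems by simp
  next
    case greater
    then show ?thesis
      using Suc.prems t_le_L[of "Suc (Suc i)"] by (intro f_t_le_right) auto
  qed simp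
  then have "f (t (Suc (Suc i))) (lam (Suc i)) \<le> f j (lam (Suc i))"
    using f_t_Suc_lam Suc.prems by simp
  then show ?case
    using f_diff_mono[OF \<open>j < t (Suc (Suc i))\<close> t_le_L] Suc.prems by blast
qed

section \<open>Lines attaining the lower envelope\<close>

definition lowest :: "real \<Rightarrow> nat set" where
  "lowest \<mu> = {j. j \<le> L \<and> (\<forall>k\<le>L. f j \<mu> \<le> f k \<mu>)}"

lemma lowest_nonempty: "\<exists>j. j \<in> lowest \<mu>"
  using ex_is_arg_min_if_finite[of "{..L}" "\<lambda>j. f j \<mu>"]
  by (auto simp: lowest_def is_arg_min_linorder)

text \<open>Lines before \<open>t i\<close> are controlled by
  \<open>\<mu> \<le> lam (i - 1)\<close>, lines after it by \<open>lam i \<le> \<mu>\<close>. For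
  \<open>i = 0\<close> there are no earlier lines, hence no upper bound on
  \<open>\<mu>\<close>.\<close>

lemma t_in_lowest:
  assumes "i \<le> K" "lam i \<le> \<mu>" "i > 0 \<Longrightarrow> \<mu> \<le> lam (i - 1)"
  shows "t i \<in> lowest \<mu>"
proof -
  have "f (t i) \<mu> \<le> f k \<mu>" if "k \<le> L" for k
  proof (cases k "t i" rule: linorder_cases)
    case less
    then have "i > 0"
      using t_0 by (cases i) auto
    then show ?thesis
      using f_t_le_left[of "i - 1" k \<mu>] assms less by simp
  qed (use assms that f_t_le_right in auto)
  then show ?thesis
    by (simp add: lowest_def t_le_L)
qed

text \<open>Strictness at the upper end rules out earlier lines; a later line can tie with
  \<open>t i\<close> only at the left end \<open>lam i\<close>.\<close>

lemma lowest_subset: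
  assumes "i \<le> K" "lam i \<le> \<mu>" "i > 0 \<Longrightarrow> \<mu> < lam (i - 1)"
  shows "lowest \<mu> \<subseteq> insert (t i) {j. t i < j \<and> j \<le> L \<and> lam i = \<mu>}"
proof
  fix k assume k: "k \<in> lowest \<mu>"
  then have le: "k \<le> L" "f k \<mu> \<le> f (t i) \<mu>"
    using t_le_L by (auto simp: lowest_def)
  show "k \<in> insert (t i) {j. t i < j \<and> j \<le> L \<and> lam i = \<mu>}"
  proof (cases k "t i" rule: linorder_cases)
    case less
    then have "i > 0"
      using t_0 by (cases i) auto
    then have "f (t i) \<mu> < f k \<mu>"
      using f_t_le_left[of "i - 1" k \<mu>] assms less by simp
    with le show ?thesis by simp
  next
    case greater
    then show ?thesis
      using f_t_le_right(2)[of i k \<mu>] assms le by force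
  qed simp
qed

lemma lowest_eq_t:
  assumes "i \<le> K" "lam i < \<mu>" "i > 0 \<Longrightarrow> \<mu> < lam (i - 1)"
  shows "lowest \<mu> = {t i}"
  using t_in_lowest[of i \<mu>] lowest_subset[of i \<mu>] assms by fastforce

text \<open>A line after \<open>t i\<close> ties with it at \<open>lam i\<close> exactly when the
  two cross there, which is membership in \<open>\<Lambda> i\<close>. This is the source of the
  union of solution sets at a breakpoint.\<close>

lemma lowest_lam:
  assumes "i < K"
  shows "lowest (lam i) = insert (t i) (\<Lambda> i)"
proof -
  have left: "i > 0 \<Longrightarrow> lam i < lam (i - 1)"
    using lam_Suc_less[of "i - 1"] assms by simp
  then have ti: "t i \<in> lowest (lam i)"
    using assms by (intro t_in_lowest) auto
  have "k \<in> lowest (lam i) \<longleftrightarrow> k \<in> \<Lambda> i" if k: "t i < k" "k \<le> L" for k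
  proof -
    have "k \<in> lowest (lam i) \<longleftrightarrow> f k (lam i) \<le> f (t i) (lam i)"
      using ti k by (auto simp: lowest_def intro: order_trans)
    also have "\<dots> \<longleftrightarrow> lam i \<le> ratio \<rho> s (t i) k"
      using f_less_iff[OF k, of "lam i"] by (simp add: not_less[symmetric])
    also have "\<dots> \<longleftrightarrow> k \<in> \<Lambda> i"
      using ratio_le_lam[OF assms k] k by (auto simp: Lambda_eq[OF assms])
    finally show ?thesis .
  qed
  then show ?thesis
    using ti lowest_subset[of i "lam i"] left assms by (auto simp: Lambda_eq[OF assms])
qed

lemma zero_notin_lowest:
  assumes "\<mu> < lam 0" "K > 0"
  shows "0 \<notin> lowest \<mu>"
  using f_less_iff[OF t_less_Suc t_le_L, of 0 \<mu>] lam_eq[of 0] assms t_0 t_le_L[of "Suc 0"]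
    f_le_iff[OF t_less_Suc t_le_L, of 0 \<mu>]
  by (auto simp: lowest_def not_le)

section \<open>Continuity and piecewise linearity of the envelope\<close>

lemma continuous_on_envelope:
  assumes "\<And>\<mu> j. \<mu> \<in> S \<Longrightarrow> j \<in> lowest \<mu> \<Longrightarrow> F \<mu> = f j \<mu>"
  shows "continuous_on S F"
proof -
  \<comment> \<open>The envelope is a pointwise minimum of finitely many affine functions; the
    induction adds one line at a time.\<close>
  have "continuous_on S (\<lambda>\<mu>. Min ((\<lambda>j. f j \<mu>) ` {..n}))" for n
  proof (induction n)
    case 0
    then show ?case
      by (simp add: f_def) (intro continuous_intros)
  next
    case (Suc n)
    have "continuous_on S (\<lambda>\<mu>. min (f (Suc n) \<mu>) (Min ((\<lambda>j. f j \<mu>) ` {..n})))"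
      using Suc unfolding f_def by (intro continuous_intros)
    then show ?case
      by (simp add: atMost_Suc)
  qed
  moreover have "F \<mu> = Min ((\<lambda>j. f j \<mu>) ` {..L})" if "\<mu> \<in> S" for \<mu>
  proof -
    obtain j where j: "j \<in> lowest \<mu>"
      using lowest_nonempty by blast
    then have "Min ((\<lambda>j. f j \<mu>) ` {..L}) = f j \<mu>"
      by (intro Min_eqI) (auto simp: lowest_def)
    with assms[OF that j] show ?thesis
      by simp
  qed
  ultimately show ?thesis
    by (simp cong: continuous_on_cong)
qed

text \<open>Ties between lines are broken by taking the smallest index.\<close>

lemma piecewise_linear_on_envelope:
  assumes "is_interval S" and F: "\<And>\<mu> j. \<mu> \<in> S \<Longrightarrow> j \<in> lowest \<mu> \<Longrightarrow> F \<mu> = f j \<mu>"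
  shows "piecewise_linear_on S F"
proof -
  define D where "D j = {\<mu> \<in> S. j \<in> lowest \<mu> \<and> (\<forall>k<j. k \<notin> lowest \<mu>)}" for j
  have D_eq: "D j = {\<mu> \<in> S. (\<forall>k\<le>L. f j \<mu> \<le> f k \<mu>) \<and> (\<forall>k<j. f j \<mu> < f k \<mu>)}" if "j \<le> L" for j
  proof -
    have "f j \<mu> < f k \<mu> \<longleftrightarrow> k \<notin> lowest \<mu>" if "j \<in> lowest \<mu>" "k < j" for k \<mu>
      using that \<open>j \<le> L\<close> by (auto simp: lowest_def not_le intro: less_le_trans)
    then show ?thesis
      using that by (auto simp: D_def lowest_def)
  qed
  \<comment> \<open>An affine function on \<open>[a, e]\<close> is at least the smaller of its end
    values. Applied to differences of lines, this carries weak and strict inequalities from two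
    points to all points between them, so each \<open>D j\<close> is an interval.\<close>
  have between: "c + x * d \<ge> min (c + a * d) (c + e * d)" if "a \<le> x" "x \<le> e" for a c d e x :: real
    using that mult_right_mono[of a x d] mult_right_mono_neg[of x e d] by (cases "d \<ge> 0") auto
  have interval: "is_interval (D j)" if "j \<le> L" for j
    unfolding is_interval_1
  proof (intro ballI allI impI)
    fix a e x assume a: "a \<in> D j" and e: "e \<in> D j" and x: "a \<le> x \<and> x \<le> e"
    have "x \<in> S"
      using a e x \<open>is_interval S\<close> unfolding is_interval_1 D_def by blast
    have diff: "f k x - f j x \<ge> min (f k a - f j a) (f k e - f j e)" for k
      using between[of a x e "real (s k) - real (s j)" "\<rho> k - \<rho> j"] x
      by (simp add: f_def algebra_simps)
    have "f j x \<le> f k x" if "f j a \<le> f k a" "f j e \<le> f k e" for k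
      using that diff[of k] by linarith
    moreover have "f j x < f k x" if "f j a < f k a" "f j e < f k e" for k
      using that diff[of k] by linarith
    ultimately show "x \<in> D j"
      using a e that \<open>x \<in> S\<close> by (auto simp: D_eq)
  qed
  have least: "\<exists>j\<le>L. \<mu> \<in> D j" if "\<mu> \<in> S" for \<mu>
  proof -
    define j where "j = (LEAST j. j \<in> lowest \<mu>)"
    have "j \<in> lowest \<mu>"
      unfolding j_def using lowest_nonempty by (rule LeastI_ex)
    moreover have "\<forall>k<j. k \<notin> lowest \<mu>"
      unfolding j_def by (blast dest: not_less_Least)
    ultimately show ?thesis
      using that by (auto simp: D_def lowest_def)
  qed
  \<comment> \<open>Lines that are never the first lowest one give empty pieces, which a partition
    must not contain.\<close>
  define P where "P = D ` {..L} - {{}}"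
  have "partition_on S P"
  proof (rule partition_onI)
    show "\<Union> P = S"
    proof (intro equalityI subsetI)
      fix \<mu> assume "\<mu> \<in> S"
      then obtain j where "j \<le> L" "\<mu> \<in> D j"
        using least by blast
      then show "\<mu> \<in> \<Union> P"
        unfolding P_def by blast
    qed (auto simp: P_def D_def)
    show "disjnt p q" if "p \<in> P" "q \<in> P" "p \<noteq> q" for p q
    proof -
      obtain i j where ij: "p = D i" "q = D j" "i \<noteq> j"
        using \<open>p \<in> P\<close> \<open>q \<in> P\<close> \<open>p \<noteq> q\<close> unfolding P_def by blast
      then consider "i < j" | "j < i"
        by linarith
      then show ?thesis
        by cases (auto simp: ij disjnt_def D_def)
    qed
  qed (simp add: P_def)
  moreover have "\<exists>c d. \<forall>x\<in>D j. F x = c * x + d" for j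
    using F by (intro exI[of _ "\<rho> j"] exI[where x = "real (s j)"]) (auto simp: D_def f_def)
  ultimately show ?thesis
    unfolding piecewise_linear_on_def using interval by (intro exI[of _ P]) (auto simp: P_def)
qed

end

subsection \<open>Attainment of the constrained minima\<close>

text \<open>For \<open>p = 2\<close> the two sides agree; for \<open>p = 1\<close> the Euclidean
  norm is bounded by the sum of absolute values. Supplies bounded sublevel sets and nonnegativity of
  \<open>lpnorm\<close>.\<close>

lemma lpnorm_ge_norm:
  assumes "p \<in> {1, 2}"
  shows "norm y \<le> lpnorm p y"
  using assms norm_le_l1_cart[of y]
  by (auto simp: lpnorm_def norm_vec_def L2_set_def sqrt_def)

text \<open>The vectors with at most \<open>k\<close> nonzero entries form a finite union of
  coordinate subspaces, each mapped to a translate of a subspace, which is closed. Working with the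
  image avoids the kernel of \<open>A\<close>, along which preimages may be unbounded.\<close>

lemma closed_image_sparse:
  fixes A :: "real ^ 'n ^ 'm"
  shows "closed ((\<lambda>x. A *v x - b) ` {x. l0norm x \<le> k})"
proof -
  define V :: "'n set \<Rightarrow> (real ^ 'n) set" where "V S = {x. \<forall>i. i \<notin> S \<longrightarrow> x $ i = 0}" for S
  have "closed ((\<lambda>x. A *v x - b) ` V S)" for S
  proof -
    have "subspace (V S)"
      by (auto simp: V_def subspace_def)
    then have "closed ((*v) A ` V S)"
      by (intro closed_subspace linear_subspace_image) auto
    then have "closed ((\<lambda>y. y - b) ` (*v) A ` V S)"
      by (rule closed_translation_subtract)
    then show ?thesis
      by (simp add: image_image)
  qed
  moreover have "{x. l0norm x \<le> k} = (\<Union>S\<in>{S. card S \<le> k}. V S)"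
  proof (intro equalityI subsetI)
    fix x :: "real ^ 'n" assume "x \<in> {x. l0norm x \<le> k}"
    then show "x \<in> (\<Union>S\<in>{S. card S \<le> k}. V S)"
      by (intro UN_I[of "{i. x $ i \<noteq> 0}"]) (auto simp: V_def l0norm_def)
  next
    fix x assume "x \<in> (\<Union>S\<in>{S. card S \<le> k}. V S)"
    then obtain S where "card S \<le> k" "x \<in> V S"
      by blast
    moreover have "card {i. x $ i \<noteq> 0} \<le> card S"
      using \<open>x \<in> V S\<close> by (intro card_mono) (auto simp: V_def)
    ultimately show "x \<in> {x. l0norm x \<le> k}"
      by (simp add: l0norm_def)
  qed
  ultimately show ?thesis
    by (simp add: image_UN closed_UN)
qed

lemma l0norm_zero [simp]: "l0norm 0 = 0"
  by (simp add: l0norm_def)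

lemma l0norm_eq_0_iff: "l0norm x = 0 \<longleftrightarrow> x = 0"
  by (auto simp: l0norm_def vec_eq_iff)

lemma l0norm_le_card: "l0norm (x :: real ^ 'n) \<le> CARD('n)"
  unfolding l0norm_def by (intro card_mono) auto

text \<open>Cutting \<open>C\<close> with the Euclidean ball of radius \<open>lpnorm p y0\<close>
  leaves a compact set, and points of \<open>C\<close> outside it have larger \<open>lpnorm\<close>
  than \<open>y0\<close>.\<close>

lemma lpnorm_attains_min:
  assumes p: "p \<in> {1, 2}" and "closed C" "C \<noteq> {}"
  obtains y where "y \<in> C" "\<And>z. z \<in> C \<Longrightarrow> lpnorm p y \<le> lpnorm p z"
proof -
  obtain y0 where y0: "y0 \<in> C"
    using \<open>C \<noteq> {}\<close> by blast
  define D where "D = C \<inter> cball 0 (lpnorm p y0)"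
  have "compact D"
    unfolding D_def using \<open>closed C\<close> by (simp add: closed_Int_compact)
  moreover have "y0 \<in> D"
    using y0 lpnorm_ge_norm[OF p] by (simp add: D_def)
  moreover have "continuous_on D (lpnorm p)"
    unfolding lpnorm_def by (intro continuous_intros)
  ultimately obtain y where y: "y \<in> D" "\<And>z. z \<in> D \<Longrightarrow> lpnorm p y \<le> lpnorm p z"
    using continuous_attains_inf[of D "lpnorm p"] by blast
  show ?thesis
  proof
    show "y \<in> C"
      using y(1) by (simp add: D_def)
    show "lpnorm p y \<le> lpnorm p z" if "z \<in> C" for z
    proof (cases "z \<in> D")
      case False
      then have "lpnorm p y0 < norm z"
        using that by (simp add: D_def)
      then show ?thesis
        using y(2)[OF \<open>y0 \<in> D\<close>] lpnorm_ge_norm[OF p, of z] by linarith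
    qed (rule y(2))
  qed
qed

text \<open>The residual norm is minimized over the closed image, and monotonicity of
  \<open>\<phi>\<close> on \<open>{0..}\<close> transfers the minimizer.\<close>

lemma data_fit_attains_min:
  fixes A :: "real ^ 'n ^ 'm"
  assumes p: "p \<in> {1, 2}" and mono: "mono_on {0..} \<phi>"
  shows "\<exists>x. l0norm x \<le> k \<and>
    (\<forall>y. l0norm y \<le> k \<longrightarrow> \<phi> (lpnorm p (A *v x - b)) \<le> \<phi> (lpnorm p (A *v y - b)))"
proof -
  let ?C = "(\<lambda>x. A *v x - b) ` {x. l0norm x \<le> k}"
  have "0 \<in> {x :: real ^ 'n. l0norm x \<le> k}"
    by simp
  then have "?C \<noteq> {}"
    by blast
  then obtain y where y: "y \<in> ?C" "\<And>z. z \<in> ?C \<Longrightarrow> lpnorm p y \<le> lpnorm p z"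
    using lpnorm_attains_min[OF p closed_image_sparse] by blast
  have "0 \<le> lpnorm p z" for z :: "real ^ 'm"
    using norm_ge_zero lpnorm_ge_norm[OF p] by (rule order_trans)
  then have "\<phi> (lpnorm p y) \<le> \<phi> (lpnorm p z)" if "z \<in> ?C" for z
    using y(2)[OF that] by (intro mono_onD[OF mono]) auto
  then show ?thesis
    using y(1) by blast
qed

subsection \<open>Iteration 1\<close>

lemma min_value_eqI:
  assumes "P x" "\<And>y. P y \<Longrightarrow> h x \<le> h y"
  shows "min_value h P = h x"
  unfolding min_value_def using assms by (intro Least_equality) auto

lemma min_sparsity_attained:
  assumes "g x = r"
  obtains y where "g y = r" "l0norm y = min_sparsity g r" "\<And>z. g z = r \<Longrightarrow> l0norm y \<le> l0norm z"
proof -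
  obtain y where y: "g y = r" "\<And>z. g z = r \<Longrightarrow> l0norm y \<le> l0norm z"
    using ex_has_least_nat[of "\<lambda>x. g x = r" x l0norm] assms by blast
  then have "min_sparsity g r = l0norm y"
    unfolding min_sparsity_def by (intro min_value_eqI)
  with y show ?thesis
    using that by metis
qed

declare iter1_rho.simps [simp del]

text \<open>The analysis of Iteration 1 rests on minima at every sparsity level, so
  \<open>A\<close>, \<open>b\<close>, \<open>p\<close> and \<open>\<phi>\<close> are hidden behind
  \<open>g\<close>.\<close>

locale sparse_fit =
  fixes g :: "real ^ 'n \<Rightarrow> real"
  assumes attained: "\<exists>x. l0norm x \<le> k \<and> (\<forall>y. l0norm y \<le> k \<longrightarrow> g x \<le> g y)"
begin

abbreviation "\<rho> \<equiv> iter1_rho g"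
abbreviation "s \<equiv> iter1_s g"
abbreviation "L \<equiv> iter1_L g"

text \<open>Treats both clauses of the recursion alike: the unconstrained minimum
  \<open>\<rho> 0\<close> is the minimum under the vacuous bound \<open>CARD('n)\<close>.\<close>

lemma rho_min_upto_sparsity:
  obtains k where "\<And>y. l0norm y \<le> k \<Longrightarrow> \<rho> i \<le> g y" "\<exists>x. l0norm x \<le> k \<and> g x = \<rho> i"
    "i = 0 \<Longrightarrow> k = CARD('n)" "\<And>j. i = Suc j \<Longrightarrow> k = s j - 1"
proof (cases i)
  case 0
  obtain x where x: "\<And>y. g x \<le> g y"
    using attained[of "CARD('n)"] l0norm_le_card by blast
  then have "\<rho> i = g x"
    using 0 by (simp add: min_value_eqI iter1_rho.simps)
  with x 0 show ?thesis
    by (intro that[of "CARD('n)"]) (auto simp: l0norm_le_card)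
next
  case (Suc j)
  obtain x where x: "l0norm x \<le> s j - 1" "\<And>y. l0norm y \<le> s j - 1 \<Longrightarrow> g x \<le> g y"
    using attained by blast
  then have "\<rho> i = g x"
    using Suc by (simp add: min_value_eqI iter1_s_def iter1_rho.simps)
  with x Suc show ?thesis
    by (intro that[of "s j - 1"]) auto
qed

lemma s_attained: "\<exists>x. g x = \<rho> i \<and> l0norm x = s i"
  and s_le: "g y = \<rho> i \<Longrightarrow> s i \<le> l0norm y"
proof -
  obtain x0 where "g x0 = \<rho> i"
    by (rule rho_min_upto_sparsity[of i]) auto
  then obtain x where x: "g x = \<rho> i" "l0norm x = s i" "\<And>z. g z = \<rho> i \<Longrightarrow> l0norm x \<le> l0norm z"
    using min_sparsity_attained[of g x0 "\<rho> i"] unfolding iter1_s_def by blast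
  then show "\<exists>x. g x = \<rho> i \<and> l0norm x = s i" and "g y = \<rho> i \<Longrightarrow> s i \<le> l0norm y"
    by auto
qed

lemma rho_0_le: "\<rho> 0 \<le> g y"
  by (rule rho_min_upto_sparsity[of 0]) (simp add: l0norm_le_card)

lemma rho_Suc_le: "l0norm y \<le> s i - 1 \<Longrightarrow> \<rho> (Suc i) \<le> g y"
  by (rule rho_min_upto_sparsity[of "Suc i"]) simp

lemma s_Suc_less: "s i > 0 \<Longrightarrow> s (Suc i) < s i"
  by (rule rho_min_upto_sparsity[of "Suc i"]) (fastforce dest!: s_le)

text \<open>\<open>\<rho> i\<close> is a minimum over some sparsity bound \<open>k\<close> and is
  attained within that bound, so \<open>s i \<le> k\<close>.\<close>

lemma rho_le: "l0norm y \<le> s i \<Longrightarrow> \<rho> i \<le> g y"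
  by (rule rho_min_upto_sparsity[of i]) (use s_le in fastforce)

text \<open>A sparsest point at level \<open>\<rho> (Suc i)\<close> has fewer than
  \<open>s i\<close> nonzero entries, so its value is at least \<open>\<rho> i\<close>; equality
  would contradict the minimality of \<open>s i\<close>.\<close>

lemma rho_less_Suc:
  assumes "s i > 0"
  shows "\<rho> i < \<rho> (Suc i)"
proof -
  obtain x where x: "g x = \<rho> (Suc i)" "l0norm x = s (Suc i)"
    using s_attained by blast
  then have "l0norm x < s i"
    using s_Suc_less assms by simp
  then have "\<rho> i \<le> g x" "g x \<noteq> \<rho> i"
    using rho_le[of x i] s_le[of x i] by auto
  with x show ?thesis
    by simp
qed

text \<open>While positive, \<open>s\<close> strictly decreases in the naturals, so it must reach
  0.\<close>

lemma s_L: "s L = 0"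
proof -
  have "\<exists>i. s i = 0"
  proof (rule ccontr)
    assume "\<nexists>i. s i = 0"
    then have "\<forall>i. (s (Suc i), s i) \<in> less_than"
      using s_Suc_less by simp
    then show False
      using wf_less_than unfolding wf_iff_no_infinite_down_chain by blast
  qed
  then show ?thesis
    unfolding iter1_L_def by (rule LeastI_ex)
qed

lemma s_pos: "i < L \<Longrightarrow> s i > 0"
  using not_less_Least unfolding iter1_L_def by blast

lemma s_less: "i < j \<Longrightarrow> j \<le> L \<Longrightarrow> s j < s i"
proof (induction j)
  case (Suc j)
  then have "s (Suc j) < s j"
    by (simp add: s_Suc_less s_pos)
  then show ?case
    using Suc by (cases "i = j") auto
qed simp

lemma rho_less: "i < j \<Longrightarrow> j \<le> L \<Longrightarrow> \<rho> i < \<rho> j"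
proof (induction j)
  case (Suc j)
  then have "\<rho> j < \<rho> (Suc j)"
    by (simp add: rho_less_Suc s_pos)
  then show ?case
    using Suc by (cases "i = j") auto
qed simp

text \<open>Take the first \<open>i\<close> with \<open>s i\<close> at most the sparsity of
  \<open>x\<close>; \<open>L\<close> qualifies since \<open>s L = 0\<close>. If
  \<open>i = Suc j\<close>, then \<open>x\<close> has fewer than \<open>s j\<close> nonzero entries
  and so competes in the minimum defining \<open>\<rho> i\<close>.\<close>

lemma dominated: "\<exists>i\<le>L. s i \<le> l0norm x \<and> \<rho> i \<le> g x"
proof -
  define i where "i = (LEAST i. s i \<le> l0norm x)"
  have L: "s L \<le> l0norm x"
    by (simp add: s_L)
  then have "s i \<le> l0norm x" "i \<le> L"
    unfolding i_def by (rule LeastI, rule Least_le)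
  moreover have "\<rho> i \<le> g x"
  proof (cases i)
    case 0
    then show ?thesis by (simp only: rho_0_le)
  next
    case (Suc j)
    then have "\<not> s j \<le> l0norm x"
      using not_less_Least[of j "\<lambda>i. s i \<le> l0norm x"] unfolding i_def by simp
    then show ?thesis
      unfolding Suc by (intro rho_Suc_le) auto
  qed
  ultimately show ?thesis
    by blast
qed

lemma Omega_eq: "iter1_Omega g i = {x. l0norm x = s i \<and> g x = \<rho> i}"
proof -
  have "(\<forall>y. g y = \<rho> i \<longrightarrow> l0norm x \<le> l0norm y) \<longleftrightarrow> l0norm x = s i" if "g x = \<rho> i" for x
    using s_attained[of i] s_le[of _ i] that by (metis order_antisym)
  then show ?thesis
    by (auto simp: iter1_Omega_def argmin_set_eq)
qed

lemma Omega_L: "iter1_Omega g L = {0}"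
proof -
  have "\<rho> L = g 0"
    using s_attained[of L] by (auto simp: s_L l0norm_eq_0_iff)
  then show ?thesis
    by (auto simp: Omega_eq s_L l0norm_eq_0_iff)
qed

sublocale env: envelope \<rho> s L
  by unfold_locales (fact s_less, fact rho_less)

section \<open>The penalized objective in terms of the lowest lines\<close>

lemma objective_ge:
  assumes "\<mu> > 0" "j \<in> env.lowest \<mu>"
  shows "env.f j \<mu> \<le> l0norm x + \<mu> * g x"
proof -
  obtain i where i: "i \<le> L" "s i \<le> l0norm x" "\<rho> i \<le> g x"
    using dominated by blast
  then have "env.f j \<mu> \<le> s i + \<mu> * \<rho> i"
    using assms by (simp add: env.lowest_def env.f_def)
  also have "\<dots> \<le> l0norm x + \<mu> * g x"
    using i assms by (intro add_mono mult_left_mono) auto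
  finally show ?thesis .
qed

lemma min_objective:
  assumes "\<mu> > 0" "j \<in> env.lowest \<mu>"
  shows "min_value (\<lambda>x. l0norm x + \<mu> * g x) (\<lambda>x. True) = env.f j \<mu>"
proof -
  obtain x where x: "g x = \<rho> j" "l0norm x = s j"
    using s_attained by blast
  then show ?thesis
    using min_value_eqI[of "\<lambda>x. True" x "\<lambda>x. l0norm x + \<mu> * g x"] objective_ge[OF assms]
    by (simp add: env.f_def)
qed

lemma argmin_objective:
  assumes \<mu>: "\<mu> > 0"
  shows "argmin_set (\<lambda>x. l0norm x + \<mu> * g x) (\<lambda>x. True) = (\<Union>j\<in>env.lowest \<mu>. iter1_Omega g j)"
proof (intro equalityI subsetI)
  fix x assume x: "x \<in> argmin_set (\<lambda>x. l0norm x + \<mu> * g x) (\<lambda>x. True)"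
  obtain i where i: "i \<le> L" "s i \<le> l0norm x" "\<rho> i \<le> g x"
    using dominated by blast
  have le: "l0norm x + \<mu> * g x \<le> s k + \<mu> * \<rho> k" for k
  proof -
    obtain y where "g y = \<rho> k" "l0norm y = s k"
      using s_attained by blast
    then show ?thesis
      using x by (auto simp: argmin_set_eq dest: spec[of _ y])
  qed
  \<comment> \<open>Optimality of \<open>x\<close> bounds its objective by that of the dominating
    pair \<open>i\<close>, so both domination inequalities must be equalities.\<close>
  have "\<mu> * \<rho> i \<le> \<mu> * g x"
    using i \<mu> by simp
  then have eq: "l0norm x = s i" "\<mu> * g x = \<mu> * \<rho> i"
    using le[of i] i(2) by linarith+
  then have "i \<in> env.lowest \<mu>"
    using i(1) le \<mu> by (simp add: env.lowest_def env.f_def)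
  with eq \<mu> show "x \<in> (\<Union>j\<in>env.lowest \<mu>. iter1_Omega g j)"
    by (auto simp: Omega_eq)
next
  fix x assume "x \<in> (\<Union>j\<in>env.lowest \<mu>. iter1_Omega g j)"
  then obtain j where "j \<in> env.lowest \<mu>" "l0norm x = s j" "g x = \<rho> j"
    by (auto simp: Omega_eq)
  then show "x \<in> argmin_set (\<lambda>x. l0norm x + \<mu> * g x) (\<lambda>x. True)"
    using objective_ge[OF \<mu>, of j] by (simp add: argmin_set_eq env.f_def)
qed

end


section \<open>Optimal value and solution set as functions of the penalty parameter\<close>

theorem theorem3p8:
  fixes A :: "real ^ 'n ^ 'm" and b :: "real ^ 'm" and p :: nat and \<phi> :: "real \<Rightarrow> real"
    and g :: "real ^ 'n \<Rightarrow> real"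
    and L K :: nat and s t :: "nat \<Rightarrow> nat" and \<rho> lam :: "nat \<Rightarrow> real"
    and \<Omega>s :: "nat \<Rightarrow> (real ^ 'n) set" and \<Lambda> :: "nat \<Rightarrow> nat set"
    and f :: "nat \<Rightarrow> real \<Rightarrow> real"
    and F :: "real \<Rightarrow> real" and \<Omega> :: "real \<Rightarrow> (real ^ 'n) set"
  assumes p: "p \<in> {1, 2}"
    and \<phi>_range: "\<phi> \<in> {0..} \<rightarrow> {0..}"
    and \<phi>_cont: "continuous_on {0..} \<phi>"
    and \<phi>_mono: "mono_on {0..} \<phi>"
    and \<phi>_zero: "\<phi> 0 = 0"
    and g: "g = (\<lambda>x. \<phi> (lpnorm p (A *v x - b)))"
    and \<rho>: "\<rho> = iter1_rho g"
    and s: "s = iter1_s g"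
    and \<Omega>s: "\<Omega>s = iter1_Omega g"
    and L: "L = iter1_L g"
    and \<Lambda>: "\<Lambda> = iter2_Lambda \<rho> s L"
    and K: "K = iter2_K \<rho> s L"
    and t: "t = iter2_t \<rho> s L"
    and lam: "lam = iter2_lambda \<rho> s L"
    and f: "f = (\<lambda>i \<mu>. real (s i) + \<mu> * \<rho> i)"
    and F: "F = (\<lambda>\<mu>. min_value (\<lambda>x. real (l0norm x) + \<mu> * g x) (\<lambda>x. True))"
    and \<Omega>: "\<Omega> = (\<lambda>\<mu>. argmin_set (\<lambda>x. real (l0norm x) + \<mu> * g x) (\<lambda>x. True))"
  shows "(L = 0 \<longrightarrow> (\<forall>\<mu>>0. F \<mu> = \<rho> 0 * \<mu> \<and> \<Omega> \<mu> = {0})) \<and>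
    (L \<ge> 1 \<longrightarrow>
      ((\<forall>\<mu>\<in>{0<..lam (K - 1)}. F \<mu> = f L \<mu>) \<and>
       (\<forall>i\<in>{1..K - 1}. \<forall>\<mu>\<in>{lam i<..lam (i - 1)}. F \<mu> = f (t i) \<mu>) \<and>
       (\<forall>\<mu>\<in>{lam 0<..}. F \<mu> = f 0 \<mu>)) \<and>
      ((\<forall>\<mu>\<in>{0<..<lam (K - 1)}. \<Omega> \<mu> = \<Omega>s L \<and> \<Omega>s L = {0}) \<and>
       (\<forall>i\<in>{1..K - 1}. \<forall>\<mu>\<in>{lam i<..<lam (i - 1)}. \<Omega> \<mu> = \<Omega>s (t i)) \<and>
       (\<forall>\<mu>\<in>{lam 0<..}. \<Omega> \<mu> = \<Omega>s 0) \<and>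
       (\<forall>i\<in>{0..K - 1}. \<Omega> (lam i) = (\<Union>k\<in>\<Lambda> i. \<Omega>s k) \<union> \<Omega>s (t i))) \<and>
      (continuous_on {0<..} F \<and> piecewise_linear_on {0<..} F \<and> mono_on {0<..} F \<and>
       strict_mono_on {0<..<lam 0} F))"
proof -
  interpret sparse_fit g
    rewrites "iter1_rho g = \<rho>" and "iter1_s g = s" and "iter1_Omega g = \<Omega>s" and "iter1_L g = L"
      and "iter2_Lambda \<rho> s L = \<Lambda>" and "iter2_K \<rho> s L = K" and "iter2_t \<rho> s L = t"
      and "iter2_lambda \<rho> s L = lam"
    by (unfold_locales, unfold g, rule data_fit_attains_min[OF p \<phi>_mono])
      (simp_all only: \<rho> s \<Omega>s L \<Lambda> K t lam g)
  have g_nonneg: "g x \<ge> 0" for x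
  proof -
    have "lpnorm p (A *v x - b) \<ge> 0"
      using norm_ge_zero lpnorm_ge_norm[OF p] by (rule order_trans)
    then show ?thesis
      using \<phi>_range by (auto simp: g)
  qed
  have rho_nonneg: "\<rho> j \<ge> 0" for j
    using s_attained[of j] g_nonneg by metis
  have f_eq: "f = env.f"
    by (simp add: f env.f_def fun_eq_iff)
  have F_lowest: "F \<mu> = f j \<mu>" if "\<mu> > 0" "j \<in> env.lowest \<mu>" for \<mu> j
    using min_objective[OF that] by (simp add: F f_eq)
  have \<Omega>_lowest: "\<Omega> \<mu> = (\<Union>j\<in>env.lowest \<mu>. \<Omega>s j)" if "\<mu> > 0" for \<mu>
    using argmin_objective[OF that] by (simp add: \<Omega>)
  have \<Omega>sL: "\<Omega>s L = {0}"
    using Omega_L by simp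
  have lowest_obtain: "\<exists>j. j \<le> L \<and> j \<in> env.lowest \<mu> \<and> F \<mu> = f j \<mu>" if "\<mu> > 0" for \<mu>
    using env.lowest_nonempty[of \<mu>] F_lowest[OF that] by (auto simp: env.lowest_def)
  have F_le: "F \<mu> \<le> f j \<mu>" if "\<mu> > 0" "j \<le> L" for \<mu> j
    using lowest_obtain[OF that(1)] that(2) by (auto simp: env.lowest_def f_eq)
  have pos: "lam i \<ge> 0" if "i \<le> K" for i
    using env.lam_pos[of i] env.lam_K that by (cases "i = K") auto
  \<comment> \<open>Includes \<open>i = K\<close>, where \<open>lam K = 0\<close> and
    \<open>t K = L\<close> give the leftmost interval.\<close>
  have F_t: "F \<mu> = f (t i) \<mu>" if "i \<le> K" "i > 0" "\<mu> \<in> {lam i<..lam (i - 1)}" for i \<mu>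
    using that pos[of i] env.t_in_lowest[of i \<mu>] by (intro F_lowest) auto
  have \<Omega>_t: "\<Omega> \<mu> = \<Omega>s (t i)" if "i \<le> K" "i > 0" "\<mu> \<in> {lam i<..<lam (i - 1)}" for i \<mu>
    using that pos[of i] env.lowest_eq_t[of i \<mu>] by (subst \<Omega>_lowest) auto
  have "F \<mu> = \<rho> 0 * \<mu> \<and> \<Omega> \<mu> = {0}" if "L = 0" "\<mu> > 0" for \<mu>
  proof -
    have "env.lowest \<mu> = {0}"
      unfolding env.lowest_def using that by auto
    then show ?thesis
      using F_lowest[of \<mu> 0] \<Omega>_lowest[of \<mu>] \<Omega>sL s_L that by (simp add: f)
  qed
  moreover have "K > 0" if "L \<ge> 1"
    using env.K_pos that by simp
  moreover have "F \<mu> = f L \<mu>" if "K > 0" "\<mu> \<in> {0<..lam (K - 1)}" for \<mu>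
    using F_t[of K \<mu>] env.t_K env.lam_K that by simp
  moreover have "\<Omega> \<mu> = \<Omega>s L" if "K > 0" "\<mu> \<in> {0<..<lam (K - 1)}" for \<mu>
    using \<Omega>_t[of K \<mu>] env.t_K env.lam_K that by simp
  moreover have "F \<mu> = f (t i) \<mu>" if "i \<in> {1..K - 1}" "\<mu> \<in> {lam i<..lam (i - 1)}" for i \<mu>
    using that by (intro F_t) auto
  moreover have "\<Omega> \<mu> = \<Omega>s (t i)" if "i \<in> {1..K - 1}" "\<mu> \<in> {lam i<..<lam (i - 1)}" for i \<mu>
    using that by (intro \<Omega>_t) auto
  moreover have "F \<mu> = f 0 \<mu> \<and> \<Omega> \<mu> = \<Omega>s 0" if "\<mu> > lam 0" for \<mu>
    using that pos[of 0] env.lowest_eq_t[of 0 \<mu>] env.t_0 F_lowest[of \<mu> 0] \<Omega>_lowest[of \<mu>] by auto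
  moreover have "\<Omega> (lam i) = (\<Union>k\<in>\<Lambda> i. \<Omega>s k) \<union> \<Omega>s (t i)" if "i < K" for i
    using that env.lowest_lam[of i] env.lam_pos[of i] by (subst \<Omega>_lowest) auto
  moreover have "continuous_on {0<..} F"
    using F_lowest by (intro env.continuous_on_envelope) (auto simp: f_eq)
  moreover have "piecewise_linear_on {0<..} F"
    using F_lowest by (intro env.piecewise_linear_on_envelope) (auto simp: f_eq is_interval_1)
  moreover have "mono_on {0<..} F"
  proof (rule mono_onI)
    fix \<mu> \<nu> :: real assume *: "\<mu> \<in> {0<..}" "\<nu> \<in> {0<..}" "\<mu> \<le> \<nu>"
    obtain j where j: "j \<le> L" "F \<nu> = f j \<nu>"
      using lowest_obtain[of \<nu>] * by auto
    \<comment> \<open>The line attaining \<open>F\<close> at the larger point bounds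
      \<open>F\<close> from above at the smaller one, and its slope \<open>\<rho> j\<close> is
      nonnegative.\<close>
    have "F \<mu> \<le> f j \<mu>"
      using F_le j * by simp
    also have "\<dots> \<le> f j \<nu>"
      using rho_nonneg * by (simp add: f mult_right_mono)
    finally show "F \<mu> \<le> F \<nu>"
      using j by simp
  qed
  moreover have "strict_mono_on {0<..<lam 0} F" if "K > 0"
  proof (rule strict_mono_onI)
    fix \<mu> \<nu> :: real assume *: "\<mu> \<in> {0<..<lam 0}" "\<nu> \<in> {0<..<lam 0}" "\<mu> < \<nu>"
    obtain j where j: "j \<le> L" "j \<in> env.lowest \<nu>" "F \<nu> = f j \<nu>"
      using lowest_obtain[of \<nu>] * by auto
    then have "j > 0"
      using env.zero_notin_lowest[of \<nu>] that * by (cases "j = 0") auto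
    then have "\<rho> j > 0"
      using rho_less[of 0 j] j rho_nonneg[of 0] by simp
    have "F \<mu> \<le> f j \<mu>"
      using F_le j * by simp
    also have "\<dots> < f j \<nu>"
      using \<open>\<rho> j > 0\<close> * by (simp add: f)
    finally show "F \<mu> < F \<nu>"
      using j by simp
  qed
  moreover have "i < K" if "i \<in> {0..K - 1}" "K > 0" for i
    using that by simp
  ultimately show ?thesis
    using \<Omega>sL by (intro conjI impI ballI allI) (auto simp only: greaterThan_iff)
qed

end
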